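(* Let $k,m$ be positive integers with $m\ge 5$ and let $b\in\{0,1,2,\ldots\}$. If $b$ is even, then $$S_{k\varphi(3^m)+b}-(1-(-3)^b)S_b\equiv 3^{m-2}k(-495+1350b+567b^2-162b^3+972b^4-729b^5)\pmod{3^{m+5}}.$$ If $b$ is odd, then $$S_{k\varphi(3^m)+b}-(1-(-3)^b)S_b\equiv 3^{m-2}k(1422+1242b-891b^2-81b^3+243b^4+729b^5)\pmod{3^{m+5}}.$$
   Context: The integer sequence $\{S_n\}_{n\ge0}$ is defined by $S_0=1$ and $S_n=1-\sum_{j=0}^{n-1}\binom{n}{j}2^{2n-2j-1}S_j$ for $n\ge 1$. $\varphi$ denotes Euler's totient function. *)

theory Defs
  imports "HOL-Number_Theory.Number_Theory"
begin

(* For j < n the exponent 2 * n - 2 * j - 1 is at least 1, so the truncated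
   subtraction on nat is never actually truncated. *)
fun S :: "nat \<Rightarrow> int" where
  "S n = (if n = 0 then 1
          else 1 - (\<Sum>j = 0..<n. int (n choose j) * 2 ^ (2 * n - 2 * j - 1) * S j))"

(* The equation is recursive without pattern matching and would loop as a rewrite rule. *)
declare S.simps [simp del]

end

theory Submission
  imports Defs
begin

text \<open>
  Telescoping shows that modulo every odd \<open>M\<close> the number \<open>S n\<close> is the alternating sum of
  \<open>(4x + 1) ^ n\<close> over \<open>x < M\<close>. For \<open>M = 3 ^ N\<close> the terms with \<open>3\<close> dividing \<open>4x + 1\<close>, that is
  \<open>x = 3y + 2\<close>, contribute \<open>(-3) ^ n * S n\<close> by the reflection \<open>y \<mapsto> M/3 - 1 - y\<close>, so
  \<open>U n = (1 - (-3) ^ n) * S n\<close> is the sum over the units \<open>u = 4x + 1\<close>. For such \<open>u\<close> and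
  \<open>h = 3 ^ (m - 1) * k\<close> the difference \<open>u ^ (2 * h) - 1\<close> is \<open>h * log (u\<^sup>2)\<close> up to a multiple of
  \<open>3 ^ (2 * m)\<close>, hence modulo \<open>3 ^ (m + 5)\<close> as \<open>m \<ge> 5\<close>, and six terms of the logarithm series
  suffice. What remains is independent of \<open>m\<close> and \<open>k\<close>: a congruence modulo \<open>3 ^ 7\<close> between a
  combination of values of \<open>U\<close> and a quintic in \<open>b\<close>. The fifth differences with step \<open>2\<close> of both
  sides vanish modulo \<open>3 ^ 7\<close>, so it is enough to check \<open>b < 10\<close>.
\<close>

section \<open>Alternating power sums\<close>

text \<open>Doubling turns the odd powers of 2 into powers of 4, so that the binomial theorem can
  absorb the sum as the shift from \<open>4 * x + 1\<close> to
  \<open>4 * (x + 1) + 1\<close>.\<close>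

lemma S_recurrence:
  "2 * S n + (\<Sum>j<n. int (n choose j) * 4 ^ (n - j) * S j) = 2"
proof (cases "n = 0")
  case False
  have "2 * (\<Sum>j<n. int (n choose j) * 2 ^ (2 * n - 2 * j - 1) * S j)
      = (\<Sum>j<n. int (n choose j) * 4 ^ (n - j) * S j)"
    unfolding sum_distrib_left
  proof (rule sum.cong)
    fix j assume "j \<in> {..<n}"
    then have "2 * n - 2 * j = Suc (2 * n - 2 * j - 1)" "2 * n - 2 * j = 2 * (n - j)" by auto
    then have "(4::int) ^ (n - j) = 2 * 2 ^ (2 * n - 2 * j - 1)"
      by (metis power_Suc power_mult numeral_Bit0_eq_double power2_eq_square mult_2 one_add_one)
    then show "2 * (int (n choose j) * 2 ^ (2 * n - 2 * j - 1) * S j)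
        = int (n choose j) * 4 ^ (n - j) * S j" by simp
  qed simp
  with False show ?thesis
    by (subst S.simps) (simp add: atLeast0LessThan)
qed (simp add: S.simps)

text \<open>Modulo \<open>M\<close> the alternating sums obey the recurrence of \<open>S\<close>:
  the binomial sum shifts \<open>x\<close> by one, and adding the unshifted sum telescopes to
  \<open>1 + (4 * M + 1) ^ n\<close>. As 2 is invertible modulo \<open>M\<close>, the recurrence
  determines its solution.\<close>

lemma S_cong_alternating_sum:
  assumes "odd M"
  shows "[S n = (\<Sum>x<M. (-1) ^ x * (4 * int x + 1) ^ n)] (mod int M)"
proof (induction n rule: less_induct)
  case (less n)
  define T where "T n = (\<Sum>x<M. (-1) ^ x * (4 * int x + 1) ^ n)" for n
  have IH: "[S j = T j] (mod int M)" if "j < n" for j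
    using less that by (simp add: T_def)
  have bin: "(\<Sum>j\<le>n. int (n choose j) * 4 ^ (n - j) * T j)
      = (\<Sum>x<M. (-1) ^ x * (4 * int (Suc x) + 1) ^ n)"
  proof -
    have "(\<Sum>j\<le>n. int (n choose j) * 4 ^ (n - j) * T j)
        = (\<Sum>x<M. (-1) ^ x * (\<Sum>j\<le>n. int (n choose j) * (4 * int x + 1) ^ j * 4 ^ (n - j)))"
      unfolding T_def sum_distrib_left
      by (subst sum.swap) (simp add: mult_ac)
    also have "\<dots> = (\<Sum>x<M. (-1) ^ x * (4 * int (Suc x) + 1) ^ n)"
      by (subst binomial_ring[symmetric]) (simp add: algebra_simps)
    finally show ?thesis .
  qed
  have tel: "(\<Sum>x<M. (-1) ^ x * (4 * int (Suc x) + 1) ^ n) + T n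
      = 1 - (-1) ^ M * (4 * int M + 1) ^ n"
    unfolding T_def by (induction M) (simp_all add: algebra_simps)
  have "2 * T n + (\<Sum>j<n. int (n choose j) * 4 ^ (n - j) * T j) = 1 + (4 * int M + 1) ^ n"
    using bin tel assms by (simp add: lessThan_Suc_atMost[symmetric])
  moreover have "[1 + (4 * int M + 1) ^ n = 1 + (0 + 1) ^ n] (mod int M)"
    by (intro cong_add cong_pow cong_refl) (simp add: cong_0_iff)
  ultimately have "[2 * T n + (\<Sum>j<n. int (n choose j) * 4 ^ (n - j) * T j) = 2] (mod int M)"
    by simp
  moreover have "[(\<Sum>j<n. int (n choose j) * 4 ^ (n - j) * S j)
      = (\<Sum>j<n. int (n choose j) * 4 ^ (n - j) * T j)] (mod int M)"
    by (intro cong_sum cong_mult cong_refl) (use IH in auto)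
  ultimately have "[2 * S n + (\<Sum>j<n. int (n choose j) * 4 ^ (n - j) * S j)
      = 2 * T n + (\<Sum>j<n. int (n choose j) * 4 ^ (n - j) * S j)] (mod int M)"
    unfolding S_recurrence by (meson cong_add cong_refl cong_sym cong_trans)
  then have "[2 * S n = 2 * T n] (mod int M)"
    by (simp add: cong_add_rcancel)
  moreover have "coprime 2 (int M)"
    using assms by simp
  ultimately show ?case
    unfolding T_def using cong_mult_lcancel by blast
qed

section \<open>Units and non-units modulo 3\<close>

text \<open>An arbitrary \<open>f\<close> makes the sum linear in \<open>f\<close>, so that
  relations between values of \<open>U\<close> reduce to polynomial identities in
  \<open>u\<close>.\<close>

definition unit_sum :: "nat \<Rightarrow> (int \<Rightarrow> int) \<Rightarrow> int" where
  "unit_sum N f = (\<Sum>x | x < 3 ^ N \<and> x mod 3 \<noteq> 2. (-1) ^ x * f (4 * int x + 1))"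

lemma nonunit_sum_cong:
  "[(\<Sum>x | x < 3 ^ N \<and> x mod 3 = 2. (-1) ^ x * (4 * int x + 1) ^ n)
    = (-3) ^ n * S n] (mod 3 ^ N)"
proof (cases N)
  case (Suc M)
  let ?T = "\<Sum>y<3 ^ M. (-1) ^ y * (4 * int y + 1) ^ n"
  have "(\<Sum>x | x < 3 ^ N \<and> x mod 3 = 2. (-1) ^ x * (4 * int x + 1) ^ n)
      = (\<Sum>y<3 ^ M. (-1) ^ (3 * y + 2) * (4 * int (3 * y + 2) + 1) ^ n)"
  proof (rule sum.reindex_bij_witness[where j = "\<lambda>x. x div 3" and i = "\<lambda>y. 3 * y + 2"])
    fix x :: nat assume "x \<in> {x. x < 3 ^ N \<and> x mod 3 = 2}"
    then have "x mod 3 = 2" by simp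
    then have x: "3 * (x div 3) + 2 = x" by presburger
    from \<open>x \<in> _\<close> Suc have "x < 3 * 3 ^ M" by simp
    then show "3 * (x div 3) + 2 = x" "x div 3 \<in> {..<3 ^ M}"
      using x by auto
    show "(-1) ^ (3 * (x div 3) + 2) * (4 * int (3 * (x div 3) + 2) + 1) ^ n
        = (-1) ^ x * (4 * int x + 1) ^ n"
      unfolding x ..
  qed (use Suc in \<open>auto, presburger\<close>)
  also have "\<dots> = 3 ^ n * (\<Sum>y<3 ^ M. (-1) ^ y * (4 * int y + 3) ^ n)"
    unfolding sum_distrib_left
  proof (rule sum.cong)
    fix y :: nat
    have "(-1::int) ^ (3 * y + 2) = (-1) ^ y"
      by (simp add: minus_one_power_iff)
    moreover have "4 * int (3 * y + 2) + 1 = 3 * (4 * int y + 3)" by simp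
    ultimately show "(-1) ^ (3 * y + 2) * (4 * int (3 * y + 2) + 1) ^ n
        = 3 ^ n * ((-1) ^ y * (4 * int y + 3) ^ n)"
      by (simp only: power_mult_distrib mult_ac)
  qed simp
  also have "[\<dots> = 3 ^ n * ((-1) ^ n * S n)] (mod 3 ^ N)"
  proof (cases "n = 0")
    \<comment> \<open>Without a factor 3 the modulus cannot be lifted from \<open>3 ^ M\<close> to
      \<open>3 ^ N\<close>, but here both sides are exactly 1.\<close>
    case True
    have "(\<Sum>y<K. (-1) ^ y) = (if odd K then 1 else 0 :: int)" for K :: nat
      by (induction K) auto
    with True show ?thesis by (simp add: S.simps)
  next
    case False
    \<comment> \<open>As \<open>3 ^ M - 1\<close> is even, the reflection keeps the signs; it turns
      \<open>4 * y + 3\<close> into \<open>- (4 * y + 1)\<close> modulo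
      \<open>3 ^ M\<close>.\<close>
    have "(\<Sum>y<3 ^ M. (-1) ^ y * (4 * int y + 3) ^ n)
        = (\<Sum>y<3 ^ M. (-1) ^ (3 ^ M - Suc y) * (4 * int (3 ^ M - Suc y) + 3) ^ n)"
      by (rule sum.nat_diff_reindex[symmetric])
    also have "[\<dots> = (\<Sum>y<3 ^ M. (-1) ^ y * (- (4 * int y + 1)) ^ n)] (mod 3 ^ M)"
    proof (intro cong_sum cong_mult cong_pow)
      fix y :: nat assume "y \<in> {..<3 ^ M}"
      then have y: "Suc y \<le> 3 ^ M" by simp
      then have "even (3 ^ M - Suc y) \<longleftrightarrow> even y"
        by (subst even_diff_nat) auto
      then show "[(-1) ^ (3 ^ M - Suc y) = (-1) ^ y] (mod (3::int) ^ M)"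
        by (simp add: minus_one_power_iff)
      have "4 * int (3 ^ M - Suc y) + 3 = 4 * 3 ^ M - (4 * int y + 1)"
        using y by (simp add: of_nat_diff)
      then have "4 * int (3 ^ M - Suc y) + 3 - - (4 * int y + 1) = 3 ^ M * 4"
        by simp
      then show "[4 * int (3 ^ M - Suc y) + 3 = - (4 * int y + 1)] (mod 3 ^ M)"
        unfolding cong_iff_dvd_diff by (metis dvd_triv_left)
    qed
    also have "(\<Sum>y<3 ^ M. (-1) ^ y * (- (4 * int y + 1)) ^ n) = (-1) ^ n * ?T"
      unfolding sum_distrib_left
      by (rule sum.cong) (simp_all add: power_minus[of "4 * int _ + 1"] mult.left_commute
        del: minus_add_distrib)
    also have "[(-1) ^ n * ?T = (-1) ^ n * S n] (mod 3 ^ M)"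
      using S_cong_alternating_sum[of "3 ^ M" n]
      by (intro cong_mult cong_refl) (simp add: cong_sym)
    finally have "[3 ^ n * (\<Sum>y<3 ^ M. (-1) ^ y * (4 * int y + 3) ^ n)
        = 3 ^ n * ((-1) ^ n * S n)] (mod 3 ^ n * 3 ^ M)"
      by (simp add: cong_cmult_leftI)
    then show ?thesis
      by (rule cong_dvd_modulus)
        (use False Suc in \<open>simp add: le_imp_power_dvd flip: power_add power_Suc\<close>)
  qed
  also have "3 ^ n * ((-1) ^ n * S n) = (-3) ^ n * S n"
    by (simp add: power_minus[of 3])
  finally show ?thesis .
qed simp

lemma unit_sum_power_cong:
  "[(1 - (-3) ^ n) * S n = unit_sum N (\<lambda>u. u ^ n)] (mod 3 ^ N)"
proof -
  let ?f = "\<lambda>x. (-1) ^ x * (4 * int x + 1) ^ n"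
  have "{..<3 ^ N} = {x. x < 3 ^ N \<and> x mod 3 = 2} \<union> {x. x < 3 ^ N \<and> x mod 3 \<noteq> (2::nat)}"
    by auto
  then have "sum ?f {..<3 ^ N} = (\<Sum>x | x < 3 ^ N \<and> x mod 3 = 2. ?f x)
      + unit_sum N (\<lambda>u. u ^ n)"
    unfolding unit_sum_def by (simp only:) (rule sum.union_disjoint, auto)
  moreover have "[S n = sum ?f {..<3 ^ N}] (mod 3 ^ N)"
    using S_cong_alternating_sum[of "3 ^ N" n] by simp
  ultimately have "[S n - (-3) ^ n * S n
      = (\<Sum>x | x < 3 ^ N \<and> x mod 3 = 2. ?f x) + unit_sum N (\<lambda>u. u ^ n)
        - (\<Sum>x | x < 3 ^ N \<and> x mod 3 = 2. ?f x)] (mod 3 ^ N)"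
    by (intro cong_diff cong_sym[OF nonunit_sum_cong]) (simp only:)
  then show ?thesis by (simp add: left_diff_distrib)
qed

text \<open>Every node \<open>u\<close> is prime to 3, hence has square 1 modulo 3.\<close>

lemma unit_sum_cong:
  assumes "\<And>u. 3 dvd u\<^sup>2 - 1 \<Longrightarrow> [f u = g u] (mod d)"
  shows "[unit_sum N f = unit_sum N g] (mod d)"
  unfolding unit_sum_def
proof (intro cong_sum cong_mult cong_refl assms)
  fix x :: nat assume "x \<in> {x. x < 3 ^ N \<and> x mod 3 \<noteq> 2}"
  then consider "x mod 3 = 0" | "x mod 3 = 1" by fastforce
  then show "3 dvd (4 * int x + 1)\<^sup>2 - 1"
  proof cases
    case 1
    then obtain y where "x = 3 * y" by (metis mod_0_imp_dvd dvdE)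
    then have "(4 * int x + 1)\<^sup>2 - 1 = 3 * (8 * int y + 48 * int y ^ 2)"
      by (simp add: power2_eq_square algebra_simps)
    then show ?thesis by simp
  next
    case 2
    then have "x = 3 * (x div 3) + 1" by presburger
    then obtain y where "x = 3 * y + 1" ..
    then have "(4 * int x + 1)\<^sup>2 - 1 = 3 * (8 + 40 * int y + 48 * int y ^ 2)"
      by (simp add: power2_eq_square algebra_simps)
    then show ?thesis by simp
  qed
qed

section \<open>The 3-adic logarithm\<close>

text \<open>Sixty times the truncated series of \<open>log (1 + w)\<close>; the factor clears the denominators.\<close>
definition log60 :: "int \<Rightarrow> int" where
  "log60 w = 60 * w - 30 * w ^ 2 + 20 * w ^ 3 - 15 * w ^ 4 + 12 * w ^ 5 - 10 * w ^ 6"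

lemma log60_dvd:
  assumes "3 dvd w"
  shows "9 dvd log60 w"
proof -
  from assms obtain q where "w = 3 * q" ..
  then have "log60 w = 9 * (20 * q - 30 * q ^ 2 + 60 * q ^ 3 - 135 * q ^ 4 + 324 * q ^ 5 - 810 * q ^ 6)"
    by (simp add: log60_def power_mult_distrib)
  then show ?thesis by simp
qed

text \<open>Start of the induction on the exponent of 3; \<open>81 = 3 ^ 4\<close> belongs to
  \<open>m = 5\<close>. Binomial terms from \<open>w ^ 11\<close> on vanish modulo
  \<open>3 ^ 11\<close>.\<close>

lemma power_81_cong:
  assumes "3 dvd (w::int)"
  shows "[60 * ((1 + w) ^ 81 - 1) = 81 * log60 w] (mod 3 ^ 11)"
proof -
  from assms obtain q where w: "w = 3 * q" ..
  let ?f = "\<lambda>j. int (81 choose j) * w ^ j"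
  have "(1 + w) ^ 81 = (\<Sum>j\<le>81. ?f j)"
    using binomial_ring[of w 1 81] by (simp add: add.commute)
  also have "\<dots> = (\<Sum>j<11. ?f j) + (\<Sum>j\<in>{11..81}. ?f j)"
    by (subst sum.union_disjoint[symmetric]) (auto intro!: sum.cong)
  finally have split: "(1 + w) ^ 81 = (\<Sum>j<11. ?f j) + (\<Sum>j\<in>{11..81}. ?f j)" .
  have "3 ^ 11 dvd (\<Sum>j\<in>{11..81}. ?f j)"
  proof (intro dvd_sum dvd_mult)
    fix j :: nat assume "j \<in> {11..81}"
    then show "3 ^ 11 dvd w ^ j"
      using assms by (meson atLeastAtMost_iff dvd_power_same dvd_trans le_imp_power_dvd)
  qed
  then obtain r where r: "(\<Sum>j\<in>{11..81}. ?f j) = 3 ^ 11 * r" ..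
  have binom: "81 choose 0 = 1" "81 choose 1 = 81"
    "81 choose 2 = 3240"
    "81 choose 3 = 85320"
    "81 choose 4 = 1663740"
    "81 choose 5 = 25621596"
    "81 choose 6 = 324540216"
    "81 choose 7 = 3477216600"
    "81 choose 8 = 32164253550"
    "81 choose 9 = 260887834350"
    "81 choose 10 = 1878392407320"
    by (simp_all add: binomial_fact' fact_numeral)
  have "(\<Sum>j<11. ?f j) = sum_list (map ?f [0..<11])"
    by (simp only: interv_sum_list_conv_sum_set_nat atLeast0LessThan set_upt)
  also have "[0..<11] = [0, 1, 2, 3, 4, 5, 6, 7, 8, 9, 10::nat]"
    by code_simp
  also have "sum_list (map ?f \<dots>) = 1 + 81 * w + 3240 * w ^ 2 + 85320 * w ^ 3
      + 1663740 * w ^ 4 + 25621596 * w ^ 5 + 324540216 * w ^ 6 + 3477216600 * w ^ 7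
      + 32164253550 * w ^ 8 + 260887834350 * w ^ 9 + 1878392407320 * w ^ 10"
    by (simp add: binom)
  finally have low: "(\<Sum>j<11. ?f j) = 1 + 81 * w + 3240 * w ^ 2 + 85320 * w ^ 3
      + 1663740 * w ^ 4 + 25621596 * w ^ 5 + 324540216 * w ^ 6 + 3477216600 * w ^ 7
      + 32164253550 * w ^ 8 + 260887834350 * w ^ 9 + 1878392407320 * w ^ 10" .
  have "60 * ((1 + w) ^ 81 - 1) - 81 * log60 w = 60 * (1 + 81 * w + 3240 * w ^ 2 + 85320 * w ^ 3
      + 1663740 * w ^ 4 + 25621596 * w ^ 5 + 324540216 * w ^ 6 + 3477216600 * w ^ 7
      + 32164253550 * w ^ 8 + 260887834350 * w ^ 9 + 1878392407320 * w ^ 10 + 3 ^ 11 * r - 1)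
      - 81 * log60 w"
    by (simp only: split low r)
  \<comment> \<open>The linear terms cancel, and for \<open>2 \<le> j \<le> 10\<close> the remaining
    coefficient of \<open>w ^ j\<close> is divisible by \<open>3 ^ (11 - j)\<close>.\<close>
  also have "\<dots> = 3 ^ 11 * (10 * q ^ 2 + 780 * q ^ 3 + 45645 * q ^ 4 + 2108772 * q ^ 5
      + 80133390 * q ^ 6 + 2575716000 * q ^ 7 + 71476119000 * q ^ 8 + 1739252229000 * q ^ 9
      + 37567848146400 * q ^ 10 + 60 * r)"
    unfolding log60_def w by (simp add: power_mult_distrib)
  finally show ?thesis
    unfolding cong_iff_dvd_diff by (metis dvd_triv_left)
qed

text \<open>Since \<open>60 = 3 * 20\<close> with 20 prime to 3, cancelling costs one power of 3;
  hence the modulus \<open>3 ^ (m + 6)\<close> before the final step.\<close>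

lemma dvd_cancel_60:
  assumes "3 ^ Suc j dvd 60 * (x::int)"
  shows "3 ^ j dvd x"
proof -
  from assms have "3 * 3 ^ j dvd 3 * (20 * x)" by simp
  then have "3 ^ j dvd 20 * x"
    unfolding dvd_mult_cancel_left by simp
  moreover have "coprime (3::int) 20"
    by (rule prime_imp_coprime) auto
  then have "coprime (3 ^ j) (20::int)" by simp
  ultimately show ?thesis
    by (metis coprime_dvd_mult_right_iff)
qed

text \<open>Induction by cubing \<open>1 + e\<close>. The second conjunct makes \<open>e\<close>
  divisible by \<open>3 ^ (5 + i)\<close>, so that \<open>60 * (3 * e ^ 2 + e ^ 3)\<close> vanishes
  modulo \<open>3 ^ (12 + i)\<close> and only \<open>3 * e\<close> matters.\<close>

lemma power_power_3_cong:
  assumes "3 dvd (w::int)"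
  shows "[60 * ((1 + w) ^ 3 ^ (4 + i) - 1) = 3 ^ (4 + i) * log60 w] (mod 3 ^ (11 + i))
    \<and> [(1 + w) ^ 3 ^ (4 + i) = 1] (mod 3 ^ (5 + i))"
proof (induction i)
  case 0
  note c = power_81_cong[OF assms]
  have "(3::int) ^ Suc 5 dvd 3 ^ 11" by (simp add: le_imp_power_dvd)
  with c have "[60 * ((1 + w) ^ 81 - 1) = 81 * log60 w] (mod 3 ^ Suc 5)"
    by (rule cong_dvd_modulus)
  moreover have "[81 * log60 w = 0] (mod 3 ^ Suc 5)"
    using mult_dvd_mono[OF dvd_refl log60_dvd[OF assms], of 81] by (simp add: cong_0_iff)
  ultimately have "[60 * ((1 + w) ^ 81 - 1) = 0] (mod 3 ^ Suc 5)"
    by (rule cong_trans)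
  then have "3 ^ 5 dvd (1 + w) ^ 81 - 1"
    unfolding cong_0_iff by (rule dvd_cancel_60)
  with c show ?case
    by (simp add: cong_iff_dvd_diff)
next
  case (Suc i)
  define e where "e = (1 + w) ^ 3 ^ (4 + i) - 1"
  have "3 ^ (5 + i) dvd e"
    using Suc by (simp add: e_def cong_iff_dvd_diff)
  then obtain t where t: "e = 3 ^ (5 + i) * t" ..
  have pow: "(1 + w) ^ 3 ^ (4 + Suc i) = 1 + 3 * e + 3 * e ^ 2 + e ^ 3"
  proof -
    have "(1 + w) ^ 3 ^ (4 + Suc i) = (1 + w) ^ (3 ^ (4 + i) * 3)"
      by (simp add: power_add)
    also have "\<dots> = (1 + e) ^ 3"
      by (simp add: e_def power_mult)
    finally have "(1 + w) ^ 3 ^ (4 + Suc i) = (1 + e) ^ 3" .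
    then show ?thesis by (simp add: power2_eq_square power3_eq_cube algebra_simps)
  qed
  have "60 * ((1 + w) ^ 3 ^ (4 + Suc i) - 1) - 3 * (60 * e)
      = 3 ^ (12 + i) * (3 ^ i * 20 * t\<^sup>2 + 3 ^ (4 + i * 2) * 20 * t ^ 3)"
    unfolding pow t by (simp add: power_add power_mult power2_eq_square power3_eq_cube algebra_simps)
  then have "[60 * ((1 + w) ^ 3 ^ (4 + Suc i) - 1) = 3 * (60 * e)] (mod 3 ^ (12 + i))"
    by (simp add: cong_iff_dvd_diff)
  also have "[3 * (60 * e) = 3 * (3 ^ (4 + i) * log60 w)] (mod 3 * 3 ^ (11 + i))"
    using Suc unfolding e_def by (blast intro: cong_cmult_leftI)
  then have "[3 * (60 * e) = 3 ^ (4 + Suc i) * log60 w] (mod 3 ^ (12 + i))"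
    by (simp add: power_add mult_ac)
  finally have "[60 * ((1 + w) ^ 3 ^ (4 + Suc i) - 1) = 3 ^ (4 + Suc i) * log60 w] 
      (mod 3 ^ (11 + Suc i))"
    by simp
  moreover have "(1 + w) ^ 3 ^ (4 + Suc i) - 1 = 3 ^ (5 + Suc i) * (t + 3 ^ (5 + i) * t\<^sup>2
      + 3 ^ (9 + i * 2) * t ^ 3)"
    unfolding pow t by (simp add: power_add power_mult power2_eq_square power3_eq_cube algebra_simps)
  then have "[(1 + w) ^ 3 ^ (4 + Suc i) = 1] (mod 3 ^ (5 + Suc i))"
    by (simp add: cong_iff_dvd_diff)
  ultimately show ?case ..
qed

lemma one_plus_power_cong:
  "[(1 + e) ^ k = 1 + int k * e] (mod e ^ 2)"
proof (induction k)
  case (Suc k)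
  then have "[(1 + e) * (1 + e) ^ k = (1 + e) * (1 + int k * e)] (mod e ^ 2)"
    by (intro cong_mult cong_refl)
  also have "(1 + e) * (1 + int k * e) = 1 + int (Suc k) * e + e ^ 2 * int k"
    by (simp add: power2_eq_square algebra_simps)
  also have "[\<dots> = 1 + int (Suc k) * e] (mod e ^ 2)"
    by (simp add: cong_iff_dvd_diff)
  finally show ?case by simp
qed simp

lemma power_minus_one_cong_log60:
  assumes "3 dvd (w::int)" and "m \<ge> 5"
  shows "[60 * ((1 + w) ^ (k * 3 ^ (m - 1)) - 1) = 3 ^ (m - 1) * int k * log60 w] (mod 3 ^ (m + 6))"
proof -
  obtain i where i: "m = 5 + i" using \<open>m \<ge> 5\<close> le_Suc_ex by blast
  define e where "e = (1 + w) ^ 3 ^ (m - 1) - 1"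
  have log: "[60 * e = 3 ^ (m - 1) * log60 w] (mod 3 ^ (m + 6))" and "3 ^ m dvd e"
    using power_power_3_cong[OF \<open>3 dvd w\<close>, of i]
    by (simp_all add: e_def i cong_iff_dvd_diff add_ac)
  then have "3 ^ (m * 2) dvd e\<^sup>2"
    by (simp add: power_mult dvd_power_same)
  moreover have "e\<^sup>2 dvd (1 + e) ^ k - (1 + int k * e)"
    using one_plus_power_cong by (simp add: cong_iff_dvd_diff)
  ultimately have "3 * 3 ^ (m * 2) dvd 60 * ((1 + e) ^ k - (1 + int k * e))"
    by (intro mult_dvd_mono) (auto intro: dvd_trans)
  \<comment> \<open>This is \<open>2 * m + 1 \<ge> m + 6\<close>, that is \<open>m \<ge> 5\<close>;
    the extra 3 comes from the factor 60.\<close>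
  moreover have "(3::int) ^ (m + 6) dvd 3 * 3 ^ (m * 2)"
    using \<open>m \<ge> 5\<close> by (simp add: le_imp_power_dvd flip: power_Suc)
  ultimately have "3 ^ (m + 6) dvd 60 * ((1 + e) ^ k - (1 + int k * e))"
    by (rule dvd_trans[rotated])
  then have "[60 * ((1 + e) ^ k - 1) = int k * (60 * e)] (mod 3 ^ (m + 6))"
    by (simp add: cong_iff_dvd_diff algebra_simps)
  also have "[int k * (60 * e) = int k * (3 ^ (m - 1) * log60 w)] (mod 3 ^ (m + 6))"
    by (rule cong_mult[OF cong_refl log])
  finally show ?thesis
    by (simp add: e_def mult_ac flip: power_mult)
qed

section \<open>Fifth differences modulo \<open>3 ^ 7\<close>\<close>

definition U :: "nat \<Rightarrow> int" where
  "U n = (1 - (-3) ^ n) * S n"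

text \<open>The coefficients are those of \<open>log60 (y - 1)\<close> as a polynomial in \<open>y\<close>.\<close>
definition log_sum :: "nat \<Rightarrow> int" where
  "log_sum b = - 147 * U b + 360 * U (b + 2) - 450 * U (b + 4) + 400 * U (b + 6)
     - 225 * U (b + 8) + 72 * U (b + 10) - 10 * U (b + 12)"

lemma unit_sum_diff: "unit_sum N f - unit_sum N g = unit_sum N (\<lambda>u. f u - g u)"
  by (simp add: unit_sum_def sum_subtractf right_diff_distrib)

lemma unit_sum_add: "unit_sum N f + unit_sum N g = unit_sum N (\<lambda>u. f u + g u)"
  by (simp add: unit_sum_def sum.distrib distrib_left)

lemma unit_sum_cmult: "c * unit_sum N f = unit_sum N (\<lambda>u. c * f u)"
  by (simp add: unit_sum_def sum_distrib_left mult_ac)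

lemma U_cong: "[U n = unit_sum N (\<lambda>u. u ^ n)] (mod 3 ^ N)"
  unfolding U_def by (rule unit_sum_power_cong)

lemma log_sum_cong:
  "[log_sum b = unit_sum N (\<lambda>u. u ^ b * log60 (u\<^sup>2 - 1))] (mod 3 ^ N)"
proof -
  have "[log_sum b = - 147 * unit_sum N (\<lambda>u. u ^ b) + 360 * unit_sum N (\<lambda>u. u ^ (b + 2))
     - 450 * unit_sum N (\<lambda>u. u ^ (b + 4)) + 400 * unit_sum N (\<lambda>u. u ^ (b + 6))
     - 225 * unit_sum N (\<lambda>u. u ^ (b + 8)) + 72 * unit_sum N (\<lambda>u. u ^ (b + 10))
     - 10 * unit_sum N (\<lambda>u. u ^ (b + 12))] (mod 3 ^ N)"
    unfolding log_sum_def by (intro cong_add cong_diff cong_mult cong_refl U_cong)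
  then show ?thesis
    unfolding unit_sum_cmult unit_sum_add unit_sum_diff
    by (simp add: log60_def power_add eval_nat_numeral algebra_simps)
qed

text \<open>The fifth difference with step 2 multiplies each summand by
  \<open>(u\<^sup>2 - 1) ^ 5\<close>. This gives \<open>3 ^ 5\<close>, and \<open>log60\<close>
  gives another 9.\<close>

lemma log_sum_fifth_difference:
  "2187 dvd log_sum (b + 10) - 5 * log_sum (b + 8) + 10 * log_sum (b + 6)
     - 10 * log_sum (b + 4) + 5 * log_sum (b + 2) - log_sum b"
proof -
  let ?f = "\<lambda>b u. u ^ b * log60 (u\<^sup>2 - 1)"
  have "[log_sum (b + 10) - 5 * log_sum (b + 8) + 10 * log_sum (b + 6)
     - 10 * log_sum (b + 4) + 5 * log_sum (b + 2) - log_sum b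
     = unit_sum 7 (?f (b + 10)) - 5 * unit_sum 7 (?f (b + 8)) + 10 * unit_sum 7 (?f (b + 6))
     - 10 * unit_sum 7 (?f (b + 4)) + 5 * unit_sum 7 (?f (b + 2)) - unit_sum 7 (?f b)] (mod 3 ^ 7)"
    by (intro cong_add cong_diff cong_mult cong_refl log_sum_cong)
  also have "unit_sum 7 (?f (b + 10)) - 5 * unit_sum 7 (?f (b + 8)) + 10 * unit_sum 7 (?f (b + 6))
     - 10 * unit_sum 7 (?f (b + 4)) + 5 * unit_sum 7 (?f (b + 2)) - unit_sum 7 (?f b)
     = unit_sum 7 (\<lambda>u. u ^ b * (u\<^sup>2 - 1) ^ 5 * log60 (u\<^sup>2 - 1))"
    unfolding unit_sum_cmult unit_sum_add unit_sum_diff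
  proof (rule arg_cong[where f = "unit_sum 7"], rule ext)
    fix u :: int
    show "?f (b + 10) u - 5 * ?f (b + 8) u + 10 * ?f (b + 6) u - 10 * ?f (b + 4) u
        + 5 * ?f (b + 2) u - ?f b u = u ^ b * (u\<^sup>2 - 1) ^ 5 * log60 (u\<^sup>2 - 1)"
      by (simp add: power_add eval_nat_numeral algebra_simps)
  qed
  also have "[\<dots> = unit_sum 7 (\<lambda>u. 0)] (mod 3 ^ 7)"
  proof (rule unit_sum_cong)
    fix u :: int assume "3 dvd u\<^sup>2 - 1"
    then have "3 ^ 5 * 9 dvd (u\<^sup>2 - 1) ^ 5 * log60 (u\<^sup>2 - 1)"
      by (intro mult_dvd_mono dvd_power_same log60_dvd)
    then show "[u ^ b * (u\<^sup>2 - 1) ^ 5 * log60 (u\<^sup>2 - 1) = 0] (mod 3 ^ 7)"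
      by (simp add: cong_0_iff mult.assoc)
  qed
  finally show ?thesis
    by (simp add: unit_sum_def cong_0_iff)
qed

definition quintic :: "nat \<Rightarrow> int" where
  "quintic b = (if even b
     then - 495 + 1350 * int b + 567 * int b ^ 2 - 162 * int b ^ 3 + 972 * int b ^ 4 - 729 * int b ^ 5
     else 1422 + 1242 * int b - 891 * int b ^ 2 - 81 * int b ^ 3 + 243 * int b ^ 4 + 729 * int b ^ 5)"

text \<open>Step 2 preserves parity, and the fifth difference of \<open>c * b ^ 5\<close> is
  \<open>c * 5! * 2 ^ 5 = 3840 * c\<close>, with \<open>c\<close> being -729 or 729.\<close>

lemma quintic_fifth_difference:
  "2187 dvd quintic (b + 10) - 5 * quintic (b + 8) + 10 * quintic (b + 6) - 10 * quintic (b + 4)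
      + 5 * quintic (b + 2) - quintic b"
proof -
  have "quintic (b + 10) - 5 * quintic (b + 8) + 10 * quintic (b + 6) - 10 * quintic (b + 4)
      + 5 * quintic (b + 2) - quintic b
      = 2187 * (if even b then - 1280 else 1280)"
    by (simp add: quintic_def) (simp add: eval_nat_numeral algebra_simps)
  then show ?thesis by simp
qed

section \<open>Efficient evaluation of initial values\<close>

text \<open>For a list \<open>S\<^sub>j, \<dots>, S\<^sub>n\<^sub>-\<^sub>1\<close> and \<open>c = n choose j\<close>, the part of the sum in
  \<open>S_recurrence\<close> from \<open>j\<close> on. The next binomial coefficient comes from the previous one.\<close>
primrec S_tail_sum :: "int \<Rightarrow> int \<Rightarrow> int list \<Rightarrow> int" where
  "S_tail_sum j c [] = 0"
| "S_tail_sum j c (s # l) =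
     c * 4 ^ Suc (length l) * s + S_tail_sum (j + 1) (c * int (Suc (length l)) div (j + 1)) l"

lemma S_tail_sum:
  "S_tail_sum (int j) (int ((j + d) choose j)) (map S [j..<j + d])
    = (\<Sum>i = j..<j + d. int ((j + d) choose i) * 4 ^ (j + d - i) * S i)"
proof (induction d arbitrary: j)
  case (Suc d)
  \<comment> \<open>Absorption identity: it shows that the division in \<open>S_tail_sum\<close> is
    exact.\<close>
  have "Suc j * ((j + Suc d) choose Suc j) = ((j + Suc d) choose j) * Suc d"
    using binomial_absorb_comp[of "j + Suc d" j] binomial_absorption[of j "j + Suc d"]
    by (simp add: mult.commute)
  then have "((j + Suc d) choose j) * Suc d div Suc j = (j + Suc d) choose Suc j"
    by (metis nonzero_mult_div_cancel_left nat.distinct(1))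
  then have "int ((j + Suc d) choose j) * int (Suc d) div (int j + 1) = int ((Suc j + d) choose Suc j)"
    by (metis of_nat_mult of_nat_Suc zdiv_int add_Suc_shift add.commute)
  then have "S_tail_sum (int j) (int ((j + Suc d) choose j)) (map S (j # [Suc j..<Suc j + d]))
      = int ((j + Suc d) choose j) * 4 ^ Suc d * S j
        + S_tail_sum (int (Suc j)) (int ((Suc j + d) choose Suc j)) (map S [Suc j..<Suc j + d])"
    by (simp only: S_tail_sum.simps list.map length_map length_upt diff_add_inverse)
      (simp add: add.commute)
  also have "\<dots> = (\<Sum>i = j..<j + Suc d. int ((j + Suc d) choose i) * 4 ^ (j + Suc d - i) * S i)"
    unfolding Suc
    by (subst sum.atLeast_Suc_lessThan[of j])
      (simp_all only: less_add_Suc1 add_Suc_shift diff_add_inverse)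
  also have "j # [Suc j..<Suc j + d] = [j..<j + Suc d]"
    by (simp add: upt_conv_Cons)
  finally show ?case .
qed simp

text \<open>Evaluating \<open>S\<close> by its defining equation takes exponentially many steps; extending the list
  of previous values does not.\<close>
definition S_snoc :: "int list \<Rightarrow> int list" where
  "S_snoc l = l @ [1 - S_tail_sum 0 1 l div 2]"

primrec S_list :: "nat \<Rightarrow> int list" where
  "S_list 0 = []"
| "S_list (Suc n) = S_snoc (S_list n)"

lemma S_list: "S_list n = map S [0..<n]"
proof (induction n)
  case (Suc n)
  have "2 * S n + S_tail_sum 0 1 (map S [0..<n]) = 2"
    using S_recurrence[of n] S_tail_sum[of 0 n] by (simp add: atLeast0LessThan)
  then have "S n = 1 - S_tail_sum 0 1 (map S [0..<n]) div 2"
    by presburger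
  with Suc show ?case by (simp add: S_snoc_def)
qed simp

text \<open>\<open>log_sum b\<close> reaches up to \<open>S (b + 12)\<close>, so the base cases
  \<open>b < 10\<close> require values up to \<open>S 21\<close>.\<close>

lemma S_list_22: "S_list 22 = [1, -1, -3, 11, 57, -361, -2763, 24611, 250737, -2873041, -36581523,
      512343611, 7828053417, -129570724921, -2309644635483, 44110959165011, 898621108880097,
      -19450718635716001, -445777636063460643, 10784052561125704811, 274613643571568682777,
      -7342627959965776406281]"
  by code_simp

lemma S_eq_nth_S_list: "n < 22 \<Longrightarrow> S n = S_list 22 ! n"
  by (simp add: S_list)

lemma log_sum_cong_quintic_base:
  assumes "b < 10"
  shows "2187 dvd log_sum b - 20 * quintic b"
proof -
  have "b = 0 \<or> b = 1 \<or> b = 2 \<or> b = 3 \<or> b = 4 \<or> b = 5 \<or> b = 6 \<or> b = 7 \<or> b = 8 \<or> b = 9"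
    using assms by presburger
  then show ?thesis
    by (elim disjE) (simp_all add: log_sum_def U_def quintic_def S_eq_nth_S_list S_list_22)
qed

section \<open>From base cases to the congruence for \<open>S\<close>\<close>

text \<open>The factor 20 arises from \<open>60 * 3 ^ (m - 2) = 20 * 3 ^ (m - 1)\<close>. The fifth
  differences act as a recurrence with step 2, so five initial values for each parity
  suffice.\<close>

lemma log_sum_cong_quintic: "2187 dvd log_sum b - 20 * quintic b"
proof (induction b rule: less_induct)
  case (less b)
  show ?case
  proof (cases "b < 10")
    case False
    then obtain c where b: "b = c + 10" using le_Suc_ex[of 10 b] by (auto simp: add.commute)
    let ?g = "\<lambda>b. log_sum b - 20 * quintic b"
    have 1: "2187 dvd log_sum (c + 10) - 5 * log_sum (c + 8) + 10 * log_sum (c + 6)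
        - 10 * log_sum (c + 4) + 5 * log_sum (c + 2) - log_sum c
        - 20 * (quintic (c + 10) - 5 * quintic (c + 8) + 10 * quintic (c + 6)
          - 10 * quintic (c + 4) + 5 * quintic (c + 2) - quintic c)"
      by (intro dvd_diff dvd_mult log_sum_fifth_difference quintic_fifth_difference)
    \<comment> \<open>These are the lower terms of the fifth difference of \<open>?g\<close>,
      negated; adding them leaves \<open>?g (c + 10)\<close>.\<close>
    have 2: "2187 dvd 5 * ?g (c + 8) - 10 * ?g (c + 6) + 10 * ?g (c + 4) - 5 * ?g (c + 2) + ?g c"
      by (intro dvd_diff dvd_add dvd_mult less) (simp_all add: b)
    from dvd_add[OF 1 2] show ?thesis
      unfolding b by (simp add: algebra_simps)
  qed (rule log_sum_cong_quintic_base)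
qed

lemma S_cong_quintic:
  assumes "k \<ge> 1" and "m \<ge> 5"
  shows "[S (k * totient (3 ^ m) + b) - (1 - (- 3) ^ b) * S b = 3 ^ (m - 2) * int k * quintic b]
    (mod 3 ^ (m + 5))"
proof -
  define h where "h = k * 3 ^ (m - 1)"
  let ?n = "2 * h + b"
  let ?L = "S ?n - U b"
  obtain i where i: "m = 5 + i" using \<open>m \<ge> 5\<close> le_Suc_ex by blast
  have tot: "k * totient (3 ^ m) + b = ?n"
    using totient_prime_power_Suc[of 3 "m - 1"] i by (simp add: h_def mult_ac)
  \<comment> \<open>The exponent is large enough for \<open>(- 3) ^ ?n\<close> to vanish modulo
    \<open>3 ^ (m + 6)\<close>, which identifies \<open>S ?n\<close> with
    \<open>U ?n\<close>.\<close>
  have "m + 6 \<le> ?n"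
  proof -
    have "i < 3 ^ i" by (rule power_gt_expt) simp
    have "11 + i \<le> 2 * 3 ^ (4 + i)" using \<open>i < 3 ^ i\<close> by (simp add: power_add)
    also have "\<dots> \<le> k * (2 * 3 ^ (4 + i))" using \<open>k \<ge> 1\<close> by simp
    finally show ?thesis by (simp add: h_def i)
  qed
  then have "(3::int) ^ (m + 6) dvd (- 3) ^ ?n"
    by (simp add: power_minus[of 3] le_imp_power_dvd)
  then have "[S ?n = U ?n] (mod 3 ^ (m + 6))"
    by (simp add: U_def cong_iff_dvd_diff left_diff_distrib)
  then have "[60 * ?L = 60 * (U ?n - U b)] (mod 3 ^ (m + 6))"
    by (intro cong_mult cong_diff cong_refl)
  also have "[60 * (U ?n - U b)
      = 60 * (unit_sum (m + 6) (\<lambda>u. u ^ ?n) - unit_sum (m + 6) (\<lambda>u. u ^ b))]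
      (mod 3 ^ (m + 6))"
    by (intro cong_mult cong_diff cong_refl U_cong)
  also have "60 * (unit_sum (m + 6) (\<lambda>u. u ^ ?n) - unit_sum (m + 6) (\<lambda>u. u ^ b))
      = unit_sum (m + 6) (\<lambda>u. u ^ b * (60 * ((1 + (u\<^sup>2 - 1)) ^ h - 1)))"
    unfolding unit_sum_diff unit_sum_cmult
    by (simp add: power_add algebra_simps flip: power_mult)
  also have "[\<dots> = unit_sum (m + 6) (\<lambda>u. u ^ b * (3 ^ (m - 1) * int k * log60 (u\<^sup>2 - 1)))] (mod 3 ^ (m + 6))"
    unfolding h_def
    by (intro unit_sum_cong cong_mult cong_refl power_minus_one_cong_log60 \<open>m \<ge> 5\<close>)
  also have "unit_sum (m + 6) (\<lambda>u. u ^ b * (3 ^ (m - 1) * int k * log60 (u\<^sup>2 - 1)))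
      = 3 ^ (m - 1) * int k * unit_sum (m + 6) (\<lambda>u. u ^ b * log60 (u\<^sup>2 - 1))"
    unfolding unit_sum_cmult by (simp add: mult_ac)
  also have "[\<dots> = 3 ^ (m - 1) * int k * log_sum b] (mod 3 ^ (m + 6))"
    by (intro cong_mult cong_refl cong_sym[OF log_sum_cong])
  also have "[3 ^ (m - 1) * int k * log_sum b = 3 ^ (m - 1) * int k * (20 * quintic b)] (mod 3 ^ (m + 6))"
  proof -
    \<comment> \<open>The prefactor supplies \<open>3 ^ (m - 1)\<close>, so knowing
      \<open>log_sum b\<close> modulo \<open>3 ^ 7 = 2187\<close> is enough.\<close>
    have "3 ^ (m - 1) * 2187 dvd (3 ^ (m - 1) * int k) * (log_sum b - 20 * quintic b)"
      by (intro mult_dvd_mono log_sum_cong_quintic) simp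
    moreover have "(3::int) ^ (m - 1) * 2187 = 3 ^ (m + 6)"
      by (simp add: i power_add)
    ultimately show ?thesis by (simp add: cong_iff_dvd_diff algebra_simps)
  qed
  also have "3 ^ (m - 1) * int k * (20 * quintic b) = 60 * (3 ^ (m - 2) * int k * quintic b)"
    by (simp add: i power_add)
  finally have "3 ^ Suc (m + 5) dvd 60 * (?L - 3 ^ (m - 2) * int k * quintic b)"
    by (simp add: cong_iff_dvd_diff right_diff_distrib add.commute[of m])
  then have "3 ^ (m + 5) dvd ?L - 3 ^ (m - 2) * int k * quintic b"
    by (rule dvd_cancel_60)
  then show ?thesis
    unfolding tot by (simp add: cong_iff_dvd_diff U_def)
qed

theorem theorem5p1:
  fixes k m b :: nat
  assumes "k \<ge> 1" and "m \<ge> 5"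
  shows
    "(even b \<longrightarrow>
       [S (k * totient (3 ^ m) + b) - (1 - (- 3) ^ b) * S b
        = 3 ^ (m - 2) * int k *
            (- 495 + 1350 * int b + 567 * int b ^ 2 - 162 * int b ^ 3
             + 972 * int b ^ 4 - 729 * int b ^ 5)] (mod 3 ^ (m + 5)))
     \<and>
     (odd b \<longrightarrow>
       [S (k * totient (3 ^ m) + b) - (1 - (- 3) ^ b) * S b
        = 3 ^ (m - 2) * int k *
            (1422 + 1242 * int b - 891 * int b ^ 2 - 81 * int b ^ 3
             + 243 * int b ^ 4 + 729 * int b ^ 5)] (mod 3 ^ (m + 5)))"
  using S_cong_quintic[OF assms, of b]
  by (cases "even b") (simp_all only: quintic_def if_True if_False simp_thms)

end
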